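(* Let $p\in\{1,2\}$, and assume that, for every $d_x\in\mathbb N$, the link function $\ell^{\,d_x}$ is Bochner $p$-integrable, and that there exists a constant $\mathcal K_p<\infty$, independent of $d_x$, such that $$\sup_{d_x\in\mathbb N}K_p^{d_x}\le\mathcal K_p.$$ Then there exists a constant $C_p<\infty$, independent of $N$, $f$ and $d_x$, such that for every $d_x\in\mathbb N$, every $f\in B(\mathcal X)$ and every $N\in\mathbb N$, $$\|\pi_Y(f)-\pi_Y^N(f)\|_p\le\frac{C_p\,\|f\|_\infty}{\sqrt N}.$$ In particular, $\lim_{N\to\infty}\|\pi_Y(f)-\pi_Y^N(f)\|_p=0$ uniformly w.r.t. the state dimension $d_x$.
   Context: A family of models indexed by $d_x\in\mathbb N$ is given, with $d_y$ fixed. For each $d_x$: $\mathcal X\subseteq\mathbb R^{d_x}$ and $\mathcal Y\subseteq\mathbb R^{d_y}$ are Borel sets; $\pi_0$ is a probability measure on $\mathcal X$ ($\mathcal X$ and $\pi_0$ depend on $d_x$). Given $X=x$, the observation $Y$ has density $g(y\mid x)$ w.r.t. Lebesgue measure on $\mathcal Y$. We write $g_y^{d_x}(x):=g(y\mid x)$; $g$ is jointly measurable, $g_y^{d_x}(x)>0$ for all $(x,y)$, $\int_{\mathcal Y}g_y^{d_x}(x)\,\mathrm dy=1$ for all $x$, and $g_y^{d_x}\in L^2(\pi_0)$ for all $y$. For a measure $\mu$ and function $h$, $\mu(h):=\int h\,\mathrm d\mu$. The marginal law of $Y$ is $\eta(\mathrm dy):=\pi_0(g_y^{d_x})\,\mathrm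 dy$. The posterior given $y$ is $\pi_y(\mathrm dx):=g_y^{d_x}(x)\pi_0(\mathrm dx)/\pi_0(g_y^{d_x})$. Importance sampler: $x^1,\dots,x^N$ are i.i.d. from $\pi_0$, with weights $w^i=g_y^{d_x}(x^i)/\sum_{j=1}^N g_y^{d_x}(x^j)$, and $\pi_y^N:=\sum_{i=1}^N w^i\delta_{x^i}$. $\pi_Y$ and $\pi_Y^N$ denote these objects evaluated at a random observation $Y\sim\eta$, with $Y$ independent of the samples. $\|\pi_Y(f)-\pi_Y^N(f)\|_p:=\mathbb E[|\pi_Y(f)-\pi_Y^N(f)|^p]^{1/p}$, the expectation being over the joint law of $Y$ and the samples. $B(\mathcal X)$ is the set of bounded measurable functions $f:\mathcal X\to\mathbb R$, with $\|f\|_\infty=\sup|f|$. Uniformity of the limit in $d_x$ is understood for test functions with a common bound on $\|f\|_\infty$. Link function: $\ell^{\,d_x}:\mathcal Y\to L^2(\pi_0)$, $\ell_y^{\,d_x}:=g_y^{d_x}(\cdot)/\pi_0(g_y^{d_x})$. It is Bochner $p$-integrable iff it is strongly $\eta$-measurable and $K_p^{d_x}:=\int_{\mathcal Y}\|\ell_y^{\,d_x}\|_{L^2(\pi_0)}^p\,\eta(\mathrm dy)<\infty$. *)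

theory Defs
  imports "HOL-Probability.Probability"
begin

text \<open>
  The state space is a Borel subset of \<open>d\<close>-dimensional Euclidean space for every \<open>d\<close>. As \<open>d\<close> varies
  inside the statement, points of that space are functions in the carrier of
  \<open>Pi\<^sub>M {..<d} (\<lambda>_. borel)\<close>, whose sigma-algebra is the Borel one. The observation dimension is
  fixed and is therefore the cardinality of a finite type.
\<close>

type_synonym point = "nat \<Rightarrow> real"

text \<open>In \<open>g y x\<close> the observation comes first: \<open>g y\<close> is the likelihood function of \<open>y\<close>.\<close>

locale bayes_model =
  fixes d :: nat
    and X :: "point set"
    and Y :: "(real ^ 'm) set"
    and \<pi>\<^sub>0 :: "point measure"
    and g :: "real ^ 'm \<Rightarrow> point \<Rightarrow> real"
  assumes X_borel: "X \<in> sets (Pi\<^sub>M {..<d} (\<lambda>_. borel))"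
    and Y_borel: "Y \<in> sets borel"
    and prior_prob: "prob_space \<pi>\<^sub>0"
    and prior_sets: "sets \<pi>\<^sub>0 = sets (restrict_space (Pi\<^sub>M {..<d} (\<lambda>_. borel)) X)"
    and g_measurable: "(\<lambda>(y, x). g y x) \<in> borel_measurable (restrict_space borel Y \<Otimes>\<^sub>M \<pi>\<^sub>0)"
    and g_pos: "\<And>x y. x \<in> X \<Longrightarrow> y \<in> Y \<Longrightarrow> 0 < g y x"
    and g_density: "\<And>x. x \<in> X \<Longrightarrow> (\<integral>\<^sup>+ y\<in>Y. ennreal (g y x) \<partial>lborel) = 1"
    and g_L2: "\<And>y. y \<in> Y \<Longrightarrow> integrable \<pi>\<^sub>0 (\<lambda>x. (g y x)\<^sup>2)"

definition obs_law ::
    "(real ^ 'm) set \<Rightarrow> point measure \<Rightarrow> (real ^ 'm \<Rightarrow> point \<Rightarrow> real) \<Rightarrow> (real ^ 'm) measure" where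
  "obs_law Y \<pi>\<^sub>0 g = density (restrict_space lborel Y) (\<lambda>y. ennreal (\<integral>x. g y x \<partial>\<pi>\<^sub>0))"

definition link ::
    "point measure \<Rightarrow> (real ^ 'm \<Rightarrow> point \<Rightarrow> real) \<Rightarrow> real ^ 'm \<Rightarrow> point \<Rightarrow> real" where
  "link \<pi>\<^sub>0 g y x = g y x / (\<integral>z. g y z \<partial>\<pi>\<^sub>0)"

definition posterior ::
    "point measure \<Rightarrow> (real ^ 'm \<Rightarrow> point \<Rightarrow> real) \<Rightarrow> real ^ 'm \<Rightarrow> point measure" where
  "posterior \<pi>\<^sub>0 g y = density \<pi>\<^sub>0 (\<lambda>x. ennreal (g y x / (\<integral>z. g y z \<partial>\<pi>\<^sub>0)))"

definition imp_weight ::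
    "(real ^ 'm \<Rightarrow> point \<Rightarrow> real) \<Rightarrow> nat \<Rightarrow> real ^ 'm \<Rightarrow> (nat \<Rightarrow> point) \<Rightarrow> nat \<Rightarrow> real" where
  "imp_weight g N y xs i = g y (xs i) / (\<Sum>j<N. g y (xs j))"

text \<open>
  The weighted empirical measure, the sum of \<open>w i\<close> times the Dirac measure at \<open>xs i\<close>, is the image
  under \<open>xs\<close> of the measure on \<open>{..<N}\<close> with point masses \<open>w i\<close>; see \<open>integral_imp_posterior\<close>.
\<close>

definition imp_posterior ::
    "point measure \<Rightarrow> (real ^ 'm \<Rightarrow> point \<Rightarrow> real) \<Rightarrow> nat \<Rightarrow> real ^ 'm \<Rightarrow> (nat \<Rightarrow> point)
      \<Rightarrow> point measure" where
  "imp_posterior \<pi>\<^sub>0 g N y xs =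
     distr (point_measure {..<N} (\<lambda>i. ennreal (imp_weight g N y xs i))) \<pi>\<^sub>0 xs"

lemma integral_imp_posterior:
  assumes "\<And>i. i < N \<Longrightarrow> xs i \<in> space \<pi>\<^sub>0" and "\<And>i. i < N \<Longrightarrow> 0 \<le> g y (xs i)"
    and "f \<in> borel_measurable \<pi>\<^sub>0"
  shows "(\<integral>x. f x \<partial>imp_posterior \<pi>\<^sub>0 g N y xs) = (\<Sum>i<N. imp_weight g N y xs i * f (xs i))"
proof -
  have "xs \<in> measurable (point_measure {..<N} (\<lambda>i. ennreal (imp_weight g N y xs i))) \<pi>\<^sub>0"
    using assms(1) by (auto simp: measurable_point_measure_eq1)
  moreover have "0 \<le> imp_weight g N y xs i" if "i < N" for i
    using that assms(2) by (auto simp: imp_weight_def intro!: divide_nonneg_nonneg sum_nonneg)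
  ultimately show ?thesis
    unfolding imp_posterior_def using assms(3)
    by (simp add: integral_distr del: measurable_point_measure_eq1)
      (subst lebesgue_integral_point_measure_finite, auto)
qed

text \<open>\<open>Y\<close> is independent of the \<open>N\<close> independent draws from the prior.\<close>

definition joint_law ::
    "(real ^ 'm) set \<Rightarrow> point measure \<Rightarrow> (real ^ 'm \<Rightarrow> point \<Rightarrow> real) \<Rightarrow> nat
      \<Rightarrow> ((real ^ 'm) \<times> (nat \<Rightarrow> point)) measure" where
  "joint_law Y \<pi>\<^sub>0 g N = obs_law Y \<pi>\<^sub>0 g \<Otimes>\<^sub>M Pi\<^sub>M {..<N} (\<lambda>_. \<pi>\<^sub>0)"

definition imp_error ::
    "point measure \<Rightarrow> (real ^ 'm \<Rightarrow> point \<Rightarrow> real) \<Rightarrow> nat \<Rightarrow> (point \<Rightarrow> real)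
      \<Rightarrow> (real ^ 'm) \<times> (nat \<Rightarrow> point) \<Rightarrow> real" where
  "imp_error \<pi>\<^sub>0 g N f =
     (\<lambda>(y, xs). (\<integral>x. f x \<partial>posterior \<pi>\<^sub>0 g y) - (\<integral>x. f x \<partial>imp_posterior \<pi>\<^sub>0 g N y xs))"

definition Lp_norm :: "nat \<Rightarrow> 'a measure \<Rightarrow> ('a \<Rightarrow> real) \<Rightarrow> real" where
  "Lp_norm p M h = (\<integral>\<omega>. \<bar>h \<omega>\<bar> ^ p \<partial>M) powr (1 / real p)"

definition bounded_measurable :: "'a measure \<Rightarrow> ('a \<Rightarrow> real) set" where
  "bounded_measurable M = {f \<in> borel_measurable M. bounded (f ` space M)}"

definition sup_norm :: "'a measure \<Rightarrow> ('a \<Rightarrow> real) \<Rightarrow> real" where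
  "sup_norm M f = (SUP x\<in>space M. \<bar>f x\<bar>)"

text \<open>
  Elements of the \<open>L\<^sup>2\<close> space are given by representatives. Strong measurability of an
  \<open>L\<^sup>2\<close>-valued function is almost everywhere approximability, in the \<open>L\<^sup>2\<close> norm, by \<open>L\<^sup>2\<close>-valued
  simple functions; a simple function of classes lifts to one of representatives by choosing a
  representative for each of its finitely many values.
\<close>

definition L2_space :: "'a measure \<Rightarrow> ('a \<Rightarrow> real) set" where
  "L2_space P = {h \<in> borel_measurable P. integrable P (\<lambda>x. (h x)\<^sup>2)}"

definition L2_norm :: "'a measure \<Rightarrow> ('a \<Rightarrow> real) \<Rightarrow> real" where
  "L2_norm P h = sqrt (\<integral>x. (h x)\<^sup>2 \<partial>P)"

definition L2_strongly_measurable ::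
    "'b measure \<Rightarrow> 'a measure \<Rightarrow> ('b \<Rightarrow> 'a \<Rightarrow> real) \<Rightarrow> bool" where
  "L2_strongly_measurable M P F \<longleftrightarrow>
     F \<in> space M \<rightarrow> L2_space P \<and>
     (\<exists>s :: nat \<Rightarrow> 'b \<Rightarrow> 'a \<Rightarrow> real.
        (\<forall>n. simple_function M (s n) \<and> s n \<in> space M \<rightarrow> L2_space P) \<and>
        (AE y in M. (\<lambda>n. L2_norm P (\<lambda>x. s n y x - F y x)) \<longlonglongrightarrow> 0))"

definition bochner_moment ::
    "nat \<Rightarrow> 'b measure \<Rightarrow> 'a measure \<Rightarrow> ('b \<Rightarrow> 'a \<Rightarrow> real) \<Rightarrow> ennreal" where
  "bochner_moment p M P F = (\<integral>\<^sup>+ y. ennreal (L2_norm P (F y) ^ p) \<partial>M)"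

definition bochner_p_integrable ::
    "nat \<Rightarrow> 'b measure \<Rightarrow> 'a measure \<Rightarrow> ('b \<Rightarrow> 'a \<Rightarrow> real) \<Rightarrow> bool" where
  "bochner_p_integrable p M P F \<longleftrightarrow>
     L2_strongly_measurable M P F \<and> bochner_moment p M P F < \<infinity>"

end

theory Submission
  imports Defs
begin

text \<open>
  Fix \<open>y\<close> and write \<open>w\<close> for the link function at \<open>y\<close>, so that \<open>\<pi>\<^sub>0(w) = 1\<close>. With the empirical means
  \<open>A\<close> of \<open>w f\<close> and \<open>S\<close> of \<open>w\<close>, the error of the importance sampler is
  \<open>\<pi>\<^sub>0(w f) - A / S = (\<pi>\<^sub>0(w f) - A) + (A / S) (S - \<pi>\<^sub>0(w))\<close>. As \<open>\<bar>A / S\<bar> \<le> \<parallel>f\<parallel>\<^sub>\<infinity>\<close>, the variance bounds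
  for the two empirical means give a conditional mean square error of at most
  \<open>4 \<parallel>f\<parallel>\<^sub>\<infinity>\<^sup>2 \<parallel>w\<parallel>\<^sup>2 / N\<close>. Its power \<open>p / 2\<close> is then integrated over \<open>y\<close>.
\<close>

section \<open>Coordinates of i.i.d. samples and the variance of an empirical mean\<close>

lemma (in prob_space) integral_PiM_component:
  fixes h :: "'a \<Rightarrow> real"
  assumes "finite I" "i \<in> I" "h \<in> borel_measurable M"
  shows "(\<integral>xs. h (xs i) \<partial>Pi\<^sub>M I (\<lambda>_. M)) = (\<integral>x. h x \<partial>M)"
    and "integrable (Pi\<^sub>M I (\<lambda>_. M)) (\<lambda>xs. h (xs i)) \<longleftrightarrow> integrable M h"
proof -
  have D: "distr (Pi\<^sub>M I (\<lambda>_. M)) M (\<lambda>xs. xs i) = M"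
    using assms prob_space_axioms by (intro distr_PiM_component) auto
  have m: "(\<lambda>xs. xs i) \<in> Pi\<^sub>M I (\<lambda>_. M) \<rightarrow>\<^sub>M M"
    using assms by measurable
  show "(\<integral>xs. h (xs i) \<partial>Pi\<^sub>M I (\<lambda>_. M)) = (\<integral>x. h x \<partial>M)"
    using integral_distr[OF m assms(3)] D by simp
  show "integrable (Pi\<^sub>M I (\<lambda>_. M)) (\<lambda>xs. h (xs i)) \<longleftrightarrow> integrable M h"
    using integrable_distr_eq[OF m assms(3)] D by simp
qed

text \<open>Distinct coordinates are independent. The two factors are padded with the constant 1 on
  all other coordinates, so that the product formula over the whole index set applies; the padding
  integrates to 1 because \<open>M\<close> is a probability measure.\<close>

lemma (in prob_space) integral_PiM_mult_components:
  fixes h k :: "'a \<Rightarrow> real"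
  assumes "finite I" "i \<in> I" "j \<in> I" "i \<noteq> j" "integrable M h" "integrable M k"
  shows "(\<integral>xs. h (xs i) * k (xs j) \<partial>Pi\<^sub>M I (\<lambda>_. M)) = (\<integral>x. h x \<partial>M) * (\<integral>x. k x \<partial>M)"
    and "integrable (Pi\<^sub>M I (\<lambda>_. M)) (\<lambda>xs. h (xs i) * k (xs j))"
proof -
  interpret P: product_prob_space "\<lambda>_. M" I by unfold_locales
  define u where "u = (\<lambda>l x. if l = i then h x else if l = j then k x else 1)"
  have u: "integrable M (u l)" for l
    using assms by (cases "l = i"; cases "l = j") (simp_all add: u_def)
  have split: "(\<Prod>l\<in>I. a l) = a i * a j" if "\<And>l. l \<noteq> i \<Longrightarrow> l \<noteq> j \<Longrightarrow> a l = 1" for a :: "'b \<Rightarrow> real"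
  proof -
    have "(\<Prod>l\<in>I. a l) = (\<Prod>l\<in>{i, j}. a l)"
      using assms that by (intro prod.mono_neutral_right) auto
    then show ?thesis using assms by simp
  qed
  have 1: "(\<Prod>l\<in>I. u l (xs l)) = h (xs i) * k (xs j)" for xs
    using assms(4) by (subst split) (auto simp: u_def)
  have 2: "(\<Prod>l\<in>I. integral\<^sup>L M (u l)) = (\<integral>x. h x \<partial>M) * (\<integral>x. k x \<partial>M)"
    using assms(4) by (subst split) (auto simp: u_def prob_space)
  show "(\<integral>xs. h (xs i) * k (xs j) \<partial>Pi\<^sub>M I (\<lambda>_. M)) = (\<integral>x. h x \<partial>M) * (\<integral>x. k x \<partial>M)"
    using P.product_integral_prod[OF assms(1), of u] u 1 2 by simp
  show "integrable (Pi\<^sub>M I (\<lambda>_. M)) (\<lambda>xs. h (xs i) * k (xs j))"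
    using P.product_integrable_prod[OF assms(1), of u] u 1 by simp
qed

text \<open>After centring, the square expands into a double sum over pairs of samples. Off-diagonal
  terms have expectation zero by independence, and the \<open>N\<close> diagonal terms each give the
  variance, which is at most the second moment.\<close>

lemma (in prob_space) empirical_mean_square_error:
  fixes h :: "'a \<Rightarrow> real" and N :: nat
  assumes h[measurable]: "h \<in> borel_measurable M" and h2: "integrable M (\<lambda>x. (h x)\<^sup>2)" and N: "N \<ge> 1"
  shows "integrable (Pi\<^sub>M {..<N} (\<lambda>_. M)) (\<lambda>xs. ((\<Sum>i<N. h (xs i)) / N - expectation h)\<^sup>2)"
      (is "integrable ?P ?e")
    and "(\<integral>xs. ((\<Sum>i<N. h (xs i)) / N - expectation h)\<^sup>2 \<partial>Pi\<^sub>M {..<N} (\<lambda>_. M))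
      \<le> (\<integral>x. (h x)\<^sup>2 \<partial>M) / N"
proof -
  define c where "c x = h x - expectation h" for x
  have ih: "integrable M h"
    using square_integrable_imp_integrable[OF h h2] .
  have ic: "integrable M c" and ec: "expectation c = 0"
    using ih by (simp_all add: c_def[abs_def] prob_space)
  have ic2: "integrable M (\<lambda>x. c x * c x)"
    using ih h2 by (simp add: c_def power2_eq_square algebra_simps)
  have [measurable]: "c \<in> borel_measurable M"
    using ic by simp
  have "(\<integral>x. c x * c x \<partial>M) = (\<integral>x. (h x)\<^sup>2 \<partial>M) - (expectation h)\<^sup>2"
    using variance_eq[OF ih h2] by (simp add: c_def power2_eq_square)
  then have var: "(\<integral>x. c x * c x \<partial>M) \<le> (\<integral>x. (h x)\<^sup>2 \<partial>M)"
    by simp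
  have e: "?e = (\<lambda>xs. (\<Sum>i<N. \<Sum>j<N. c (xs i) * c (xs j)) / N\<^sup>2)"
  proof
    fix xs :: "nat \<Rightarrow> 'a"
    have "(\<Sum>i<N. h (xs i)) / N - expectation h = (\<Sum>i<N. c (xs i)) / N"
      using N by (simp add: c_def sum_subtractf field_simps)
    then show "?e xs = (\<Sum>i<N. \<Sum>j<N. c (xs i) * c (xs j)) / N\<^sup>2"
      by (simp add: power_divide power2_eq_square sum_product)
  qed
  have icc: "integrable ?P (\<lambda>xs. c (xs i) * c (xs j))" if "i < N" "j < N" for i j
  proof (cases "i = j")
    case True
    then show ?thesis
      using that ic2 integral_PiM_component(2)[of "{..<N}" i "\<lambda>x. c x * c x"] by simp
  next
    case False
    then show ?thesis
      using that ic by (intro integral_PiM_mult_components(2)) auto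
  qed
  have ecc: "(\<integral>xs. c (xs i) * c (xs j) \<partial>?P) = (if i = j then \<integral>x. c x * c x \<partial>M else 0)"
    if "i < N" "j < N" for i j
  proof (cases "i = j")
    case True
    then show ?thesis
      using that integral_PiM_component(1)[of "{..<N}" i "\<lambda>x. c x * c x"] by simp
  next
    case False
    then show ?thesis
      using that ic ec integral_PiM_mult_components(1)[of "{..<N}" i j c c] by simp
  qed
  show "integrable ?P ?e"
    unfolding e using icc by (intro integrable_divide_zero impI Bochner_Integration.integrable_sum) auto
  have "integral\<^sup>L ?P ?e = (\<Sum>i<N. \<Sum>j<N. \<integral>xs. c (xs i) * c (xs j) \<partial>?P) / N\<^sup>2"
    unfolding e integral_divide_zero using icc
    by (subst Bochner_Integration.integral_sum,
        fastforce intro: Bochner_Integration.integrable_sum)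
      (intro arg_cong2[where f = "(/)"] sum.cong refl Bochner_Integration.integral_sum, simp)
  also have "\<dots> = (\<integral>x. c x * c x \<partial>M) / N"
    using ecc N by (simp add: power2_eq_square)
  also have "\<dots> \<le> (\<integral>x. (h x)\<^sup>2 \<partial>M) / N"
    using var by (simp add: divide_right_mono)
  finally show "integral\<^sup>L ?P ?e \<le> (\<integral>x. (h x)\<^sup>2 \<partial>M) / N" .
qed

section \<open>Self-normalized averages\<close>

text \<open>A weighted average cannot exceed the largest absolute value averaged. If the total
  weight is 0, the quotient is 0 by the convention for division, and \<open>0 \<le> F\<close> covers
  that case.\<close>

lemma abs_weighted_mean_le:
  fixes w f :: "'a \<Rightarrow> real"
  assumes "\<And>i. i \<in> I \<Longrightarrow> 0 \<le> w i" "\<And>i. i \<in> I \<Longrightarrow> \<bar>f i\<bar> \<le> F" "0 \<le> F"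
  shows "\<bar>(\<Sum>i\<in>I. w i * f i) / (\<Sum>i\<in>I. w i)\<bar> \<le> F"
proof -
  have S: "0 \<le> (\<Sum>i\<in>I. w i)"
    using assms by (intro sum_nonneg) auto
  have "\<bar>\<Sum>i\<in>I. w i * f i\<bar> \<le> (\<Sum>i\<in>I. w i * F)"
    using assms by (intro order.trans[OF sum_abs] sum_mono) (auto simp: abs_mult intro!: mult_left_mono)
  then have "\<bar>\<Sum>i\<in>I. w i * f i\<bar> \<le> F * (\<Sum>i\<in>I. w i)"
    by (simp add: sum_distrib_left mult.commute)
  then show ?thesis
    using S assms(3) by (cases "(\<Sum>i\<in>I. w i) = 0") (auto simp: divide_le_eq)
qed

text \<open>The inequality \<open>(u + v)\<^sup>2 \<le> 2 * u\<^sup>2 + 2 * v\<^sup>2\<close>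
  separates the errors of numerator and denominator. Each then contributes twice
  \<open>F\<^sup>2\<close> times the second moment of \<open>w\<close> over \<open>N\<close>, whence
  the factor 4.\<close>

lemma (in prob_space) self_normalized_mean_square_error:
  fixes w f :: "'a \<Rightarrow> real" and N :: nat
  assumes w[measurable]: "w \<in> borel_measurable M" and w2: "integrable M (\<lambda>x. (w x)\<^sup>2)"
    and w_pos: "\<And>x. x \<in> space M \<Longrightarrow> 0 < w x" and w1: "expectation w = 1"
    and f[measurable]: "f \<in> borel_measurable M" and F: "\<And>x. x \<in> space M \<Longrightarrow> \<bar>f x\<bar> \<le> F"
    and N: "N \<ge> 1"
  defines "err \<equiv> \<lambda>xs. (\<integral>x. w x * f x \<partial>M) - (\<Sum>i<N. w (xs i) * f (xs i)) / (\<Sum>i<N. w (xs i))"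
  shows "integrable (Pi\<^sub>M {..<N} (\<lambda>_. M)) (\<lambda>xs. (err xs)\<^sup>2)" (is "integrable ?P _")
    and "(\<integral>xs. (err xs)\<^sup>2 \<partial>Pi\<^sub>M {..<N} (\<lambda>_. M)) \<le> 4 * F\<^sup>2 * (\<integral>x. (w x)\<^sup>2 \<partial>M) / N"
proof -
  \<comment> \<open>A probability space is nonempty, so the bound on \<open>f\<close> at one point
    forces \<open>F\<close> to be nonnegative.\<close>
  obtain x0 where "x0 \<in> space M" using not_empty by blast
  then have F0: "0 \<le> F" using F[of x0] by simp
  define a where "a xs = ((\<Sum>i<N. w (xs i) * f (xs i)) / N - (\<integral>x. w x * f x \<partial>M))\<^sup>2" for xs
  define s where "s xs = ((\<Sum>i<N. w (xs i)) / N - expectation w)\<^sup>2" for xs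
  have wf: "(w x * f x)\<^sup>2 \<le> F\<^sup>2 * (w x)\<^sup>2" if "x \<in> space M" for x
    using power_mono[OF F[OF that], of 2]
    by (subst (2) mult.commute) (simp add: power_mult_distrib mult_left_mono)
  have wf2: "integrable M (\<lambda>x. (w x * f x)\<^sup>2)"
    by (rule Bochner_Integration.integrable_bound[where f = "\<lambda>x. F\<^sup>2 * (w x)\<^sup>2"])
      (use w2 wf in auto)
  have wf2_le: "(\<integral>x. (w x * f x)\<^sup>2 \<partial>M) \<le> F\<^sup>2 * (\<integral>x. (w x)\<^sup>2 \<partial>M)"
    using integral_mono[OF wf2 _ wf] w2 by simp
  have a: "integrable ?P a" "integral\<^sup>L ?P a \<le> (\<integral>x. (w x * f x)\<^sup>2 \<partial>M) / N"
    using empirical_mean_square_error[of "\<lambda>x. w x * f x" N] wf2 N by (simp_all add: a_def[abs_def])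
  have s: "integrable ?P s" "integral\<^sup>L ?P s \<le> (\<integral>x. (w x)\<^sup>2 \<partial>M) / N"
    using empirical_mean_square_error[of w N] w2 N by (simp_all add: s_def[abs_def])
  have err_le: "(err xs)\<^sup>2 \<le> 2 * a xs + 2 * F\<^sup>2 * s xs" if xs: "xs \<in> space ?P" for xs
  proof -
    have in_M: "xs i \<in> space M" if "i < N" for i
      using xs that by (auto simp: space_PiM)
    define A where "A = (\<Sum>i<N. w (xs i) * f (xs i)) / N"
    define S where "S = (\<Sum>i<N. w (xs i)) / N"
    define q where "q = (\<Sum>i<N. w (xs i) * f (xs i)) / (\<Sum>i<N. w (xs i))"
    define m where "m = (\<integral>x. w x * f x \<partial>M)"
    have "\<bar>q\<bar> \<le> F"
      unfolding q_def using F0 in_M F w_pos by (intro abs_weighted_mean_le) (auto intro: less_imp_le)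
    then have "q\<^sup>2 \<le> F\<^sup>2"
      by (metis abs_ge_zero power_mono power2_abs)
    then have q: "(q * (S - 1))\<^sup>2 \<le> F\<^sup>2 * s xs"
      by (simp add: power_mult_distrib s_def S_def w1 mult_right_mono)
    \<comment> \<open>The denominator must be nonzero before \<open>q * S\<close> can be identified
      with \<open>A\<close>; this is where \<open>N \<ge> 1\<close> and the strict positivity of
      \<open>w\<close> enter.\<close>
    have "0 < (\<Sum>i<N. w (xs i))"
      using in_M w_pos N by (intro sum_pos) (auto simp: lessThan_empty_iff)
    then have "A = q * S"
      using N by (simp add: A_def S_def q_def)
    then have "err xs = (m - A) + q * (S - 1)"
      by (simp add: err_def flip: q_def m_def) (simp add: algebra_simps)
    moreover have "(u + v)\<^sup>2 \<le> 2 * u\<^sup>2 + 2 * v\<^sup>2" for u v :: real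
      using sum_squares_bound[of u v] by (simp add: power2_sum)
    ultimately have "(err xs)\<^sup>2 \<le> 2 * (m - A)\<^sup>2 + 2 * (q * (S - 1))\<^sup>2"
      by metis
    also have "(m - A)\<^sup>2 = a xs"
      by (simp add: a_def A_def m_def power2_commute)
    finally show ?thesis using q by simp
  qed
  have [measurable]: "err \<in> borel_measurable ?P"
    unfolding err_def by measurable
  have i: "integrable ?P (\<lambda>xs. 2 * a xs + 2 * F\<^sup>2 * s xs)"
    using a s by simp
  show err2: "integrable ?P (\<lambda>xs. (err xs)\<^sup>2)"
    by (rule Bochner_Integration.integrable_bound[OF i]) (use err_le in \<open>auto intro!: AE_I2 order.trans[OF _ abs_ge_self]\<close>)
  have "(\<integral>xs. (err xs)\<^sup>2 \<partial>?P) \<le> (\<integral>xs. 2 * a xs + 2 * F\<^sup>2 * s xs \<partial>?P)"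
    using err2 i err_le by (rule integral_mono)
  also have "\<dots> = 2 * integral\<^sup>L ?P a + 2 * F\<^sup>2 * integral\<^sup>L ?P s"
    using a s by simp
  also have "\<dots> \<le> 2 * (F\<^sup>2 * (\<integral>x. (w x)\<^sup>2 \<partial>M) / N) + 2 * F\<^sup>2 * ((\<integral>x. (w x)\<^sup>2 \<partial>M) / N)"
    using order.trans[OF a(2) divide_right_mono[OF wf2_le, of "real N"]] s(2)
    by (intro add_mono mult_left_mono) auto
  finally show "(\<integral>xs. (err xs)\<^sup>2 \<partial>?P) \<le> 4 * F\<^sup>2 * (\<integral>x. (w x)\<^sup>2 \<partial>M) / N"
    by simp
qed

text \<open>Passes from mean square error to the \<open>p\<close>-th moment. The case
  \<open>p = 2\<close> is the hypothesis itself; for \<open>p = 1\<close>, nonnegativity of the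
  variance of the absolute value bounds the squared mean by the mean square.\<close>

lemma (in prob_space) nn_integral_abs_power_le_L2:
  fixes h :: "'a \<Rightarrow> real"
  assumes h: "h \<in> borel_measurable M" and h2: "integrable M (\<lambda>x. (h x)\<^sup>2)"
    and le: "(\<integral>x. (h x)\<^sup>2 \<partial>M) \<le> b\<^sup>2" and b: "0 \<le> b" and p: "p \<in> {1, 2}"
  shows "(\<integral>\<^sup>+x. ennreal (\<bar>h x\<bar> ^ p) \<partial>M) \<le> ennreal (b ^ p)"
proof (cases "p = 2")
  case True
  then show ?thesis
    using h2 le by (simp add: nn_integral_eq_integral ennreal_leI)
next
  case False
  then have [simp]: "p = 1" using p by simp
  have h1: "integrable M h"
    using square_integrable_imp_integrable[OF h h2] .
  have "variance (\<lambda>x. \<bar>h x\<bar>) \<ge> 0"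
    by (rule variance_positive)
  then have "(expectation (\<lambda>x. \<bar>h x\<bar>))\<^sup>2 \<le> b\<^sup>2"
    using variance_eq[of "\<lambda>x. \<bar>h x\<bar>"] h1 h2 le by simp
  then have "expectation (\<lambda>x. \<bar>h x\<bar>) \<le> b"
    using b by (rule power2_le_imp_le)
  then show ?thesis
    using h1 by (simp add: nn_integral_eq_integral ennreal_leI)
qed

text \<open>The real supremum dominates the values because \<open>bounded_measurable\<close> makes
  their range bounded above.\<close>

lemma abs_le_sup_norm:
  assumes "f \<in> bounded_measurable M" "x \<in> space M"
  shows "\<bar>f x\<bar> \<le> sup_norm M f"
proof -
  obtain B where "\<And>x. x \<in> space M \<Longrightarrow> \<bar>f x\<bar> \<le> B"
    using assms(1) by (auto simp: bounded_measurable_def bounded_iff)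
  then show ?thesis
    unfolding sup_norm_def using assms(2) by (intro cSUP_upper bdd_aboveI2)
qed

section \<open>Measurability and fixed-observation properties of the model\<close>

context bayes_model
begin

lemma space_prior: "space \<pi>\<^sub>0 = X"
  using sets_eq_imp_space_eq[OF prior_sets] sets.sets_into_space[OF X_borel]
  by (simp add: space_restrict_space Int_absorb2)

lemma space_obs_law: "space (obs_law Y \<pi>\<^sub>0 g) = Y"
  by (simp add: obs_law_def space_restrict_space)

lemma sets_obs_law [measurable_cong]: "sets (obs_law Y \<pi>\<^sub>0 g) = sets (restrict_space borel Y)"
  by (simp add: obs_law_def sets_restrict_space)

lemma likelihood_measurable [measurable]:
  "(\<lambda>(y, x). g y x) \<in> borel_measurable (obs_law Y \<pi>\<^sub>0 g \<Otimes>\<^sub>M \<pi>\<^sub>0)"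
  using g_measurable
  by (simp cong: measurable_cong_sets sets_pair_measure_cong add: sets_obs_law)

text \<open>Square integrability gives integrability since the prior has mass 1. The normalising
  constant is then strictly positive, so every later division by it is a genuine one.\<close>

lemma likelihood_section:
  assumes "y \<in> Y"
  shows "g y \<in> borel_measurable \<pi>\<^sub>0" "integrable \<pi>\<^sub>0 (g y)" "0 < (\<integral>x. g y x \<partial>\<pi>\<^sub>0)"
proof -
  interpret prob_space \<pi>\<^sub>0 by (rule prior_prob)
  show m: "g y \<in> borel_measurable \<pi>\<^sub>0"
    using measurable_Pair2[OF likelihood_measurable, of y] assms by (simp add: space_obs_law)
  show i: "integrable \<pi>\<^sub>0 (g y)"
    using square_integrable_imp_integrable[OF m g_L2[OF assms]] .
  show "0 < (\<integral>x. g y x \<partial>\<pi>\<^sub>0)"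
    using i g_pos assms by (intro expectation_greater AE_I2) (auto simp: space_prior)
qed

lemma link_measurable [measurable]:
  "(\<lambda>(y, x). link \<pi>\<^sub>0 g y x) \<in> borel_measurable (obs_law Y \<pi>\<^sub>0 g \<Otimes>\<^sub>M \<pi>\<^sub>0)"
proof -
  \<comment> \<open>Sigma-finiteness of the prior makes the normalising constant, an integral with a
    parameter, measurable in \<open>y\<close>.\<close>
  interpret prob_space \<pi>\<^sub>0 by (rule prior_prob)
  show ?thesis unfolding link_def by measurable
qed

text \<open>Supplies, for each single \<open>y\<close> in \<open>Y\<close>, what
  \<open>self_normalized_mean_square_error\<close> requires of its weight.\<close>

lemma link_section:
  assumes "y \<in> Y"
  shows "link \<pi>\<^sub>0 g y \<in> borel_measurable \<pi>\<^sub>0" "integrable \<pi>\<^sub>0 (\<lambda>x. (link \<pi>\<^sub>0 g y x)\<^sup>2)"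
    "x \<in> X \<Longrightarrow> 0 < link \<pi>\<^sub>0 g y x" "(\<integral>x. link \<pi>\<^sub>0 g y x \<partial>\<pi>\<^sub>0) = 1"
  using likelihood_section[OF assms] g_L2[OF assms] g_pos assms
  by (auto simp: link_def[abs_def] power_divide)

text \<open>The importance weights are invariant under scaling of the likelihood, so the likelihood
  may be replaced by the link function, whose prior mean is 1.\<close>

lemma imp_error_eq:
  assumes y: "y \<in> Y" and xs: "xs \<in> space (Pi\<^sub>M {..<N} (\<lambda>_. \<pi>\<^sub>0))" and f: "f \<in> borel_measurable \<pi>\<^sub>0"
  shows "imp_error \<pi>\<^sub>0 g N f (y, xs) = (\<integral>x. link \<pi>\<^sub>0 g y x * f x \<partial>\<pi>\<^sub>0) -
    (\<Sum>i<N. link \<pi>\<^sub>0 g y (xs i) * f (xs i)) / (\<Sum>i<N. link \<pi>\<^sub>0 g y (xs i))"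
proof -
  have in_X: "xs i \<in> X" if "i < N" for i
    using xs that by (auto simp: space_PiM space_prior)
  have z: "0 < (\<integral>x. g y x \<partial>\<pi>\<^sub>0)"
    by (rule likelihood_section(3)[OF y])
  have "(\<integral>x. f x \<partial>posterior \<pi>\<^sub>0 g y) = (\<integral>x. link \<pi>\<^sub>0 g y x * f x \<partial>\<pi>\<^sub>0)"
    unfolding posterior_def link_def[symmetric] using link_section[OF y] f
    by (subst integral_density) (auto simp: space_prior intro!: AE_I2 intro: less_imp_le)
  moreover have "(\<integral>x. f x \<partial>imp_posterior \<pi>\<^sub>0 g N y xs) = (\<Sum>i<N. imp_weight g N y xs i * f (xs i))"
    using in_X g_pos y f
    by (intro integral_imp_posterior) (auto simp: space_prior intro: less_imp_le)
  moreover have "(\<Sum>i<N. link \<pi>\<^sub>0 g y (xs i) * f (xs i)) / (\<Sum>i<N. link \<pi>\<^sub>0 g y (xs i))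
      = (\<Sum>i<N. imp_weight g N y xs i * f (xs i))"
    using z by (simp add: link_def imp_weight_def sum_divide_distrib[symmetric])
  ultimately show ?thesis
    by (simp add: imp_error_def)
qed

text \<open>In the definition of \<open>imp_error\<close> the measures themselves vary with
  \<open>y\<close> and \<open>xs\<close>, which hides measurability. The explicit formula agrees
  with it on the whole space and is visibly measurable.\<close>

lemma imp_error_measurable:
  assumes [measurable]: "f \<in> borel_measurable \<pi>\<^sub>0"
  shows "imp_error \<pi>\<^sub>0 g N f \<in> borel_measurable (joint_law Y \<pi>\<^sub>0 g N)"
proof -
  interpret prob_space \<pi>\<^sub>0 by (rule prior_prob)
  have "(\<lambda>(y, xs). (\<integral>x. link \<pi>\<^sub>0 g y x * f x \<partial>\<pi>\<^sub>0) -
      (\<Sum>i<N. link \<pi>\<^sub>0 g y (xs i) * f (xs i)) / (\<Sum>i<N. link \<pi>\<^sub>0 g y (xs i)))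
      \<in> borel_measurable (joint_law Y \<pi>\<^sub>0 g N)"
    unfolding joint_law_def by measurable
  then show ?thesis
    by (rule measurable_cong[THEN iffD1, rotated])
      (auto simp: imp_error_eq joint_law_def space_pair_measure space_obs_law)
qed

lemma L2_norm_link_measurable:
  "(\<lambda>y. L2_norm \<pi>\<^sub>0 (link \<pi>\<^sub>0 g y)) \<in> borel_measurable (obs_law Y \<pi>\<^sub>0 g)"
proof -
  interpret prob_space \<pi>\<^sub>0 by (rule prior_prob)
  show ?thesis unfolding L2_norm_def by measurable
qed

lemma sup_norm_nonneg:
  assumes "f \<in> bounded_measurable \<pi>\<^sub>0"
  shows "0 \<le> sup_norm \<pi>\<^sub>0 f"
proof -
  interpret prob_space \<pi>\<^sub>0 by (rule prior_prob)
  obtain x where "x \<in> space \<pi>\<^sub>0" using not_empty by blast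
  then show ?thesis
    using abs_le_sup_norm[OF assms, of x] by simp
qed

section \<open>From the conditional error to the joint error\<close>

text \<open>The error bound conditional on \<open>y\<close> is a constant times the norm of the link
  function at \<open>y\<close>. Integrating its \<open>p\<close>-th power over \<open>y\<close>
  produces the Bochner moment; nonnegative integrals let Tonelli apply before integrability is
  known.\<close>

lemma nn_integral_imp_error_le:
  assumes f: "f \<in> bounded_measurable \<pi>\<^sub>0" and N: "N \<ge> 1" and p: "p \<in> {1, 2}"
  shows "(\<integral>\<^sup>+\<omega>. ennreal (\<bar>imp_error \<pi>\<^sub>0 g N f \<omega>\<bar> ^ p) \<partial>joint_law Y \<pi>\<^sub>0 g N)
    \<le> ennreal ((2 * sup_norm \<pi>\<^sub>0 f / sqrt N) ^ p) *
       bochner_moment p (obs_law Y \<pi>\<^sub>0 g) \<pi>\<^sub>0 (link \<pi>\<^sub>0 g)"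
proof -
  interpret prob_space \<pi>\<^sub>0 by (rule prior_prob)
  let ?P = "Pi\<^sub>M {..<N} (\<lambda>_. \<pi>\<^sub>0)" and ?F = "sup_norm \<pi>\<^sub>0 f"
  interpret P: prob_space ?P by (intro prob_space_PiM prior_prob)
  have fm: "f \<in> borel_measurable \<pi>\<^sub>0"
    using f by (simp add: bounded_measurable_def)
  note [measurable] = L2_norm_link_measurable imp_error_measurable[OF fm, unfolded joint_law_def]
  note F = abs_le_sup_norm[OF f]
  have F0: "0 \<le> ?F"
    by (rule sup_norm_nonneg[OF f])
  have sec: "(\<integral>\<^sup>+xs. ennreal (\<bar>imp_error \<pi>\<^sub>0 g N f (y, xs)\<bar> ^ p) \<partial>?P)
      \<le> ennreal ((2 * ?F / sqrt N) ^ p) * ennreal (L2_norm \<pi>\<^sub>0 (link \<pi>\<^sub>0 g y) ^ p)" if y: "y \<in> Y" for y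
  proof -
    \<comment> \<open>The square root of the conditional mean square bound.\<close>
    let ?b = "2 * ?F / sqrt N * L2_norm \<pi>\<^sub>0 (link \<pi>\<^sub>0 g y)"
    note eq = imp_error_eq[OF y _ fm]
    have m: "(\<lambda>xs. imp_error \<pi>\<^sub>0 g N f (y, xs)) \<in> borel_measurable ?P"
      using y by (intro measurable_Pair2[where x = y, OF imp_error_measurable[OF fm, unfolded joint_law_def]])
        (simp add: space_obs_law)
    note ms = self_normalized_mean_square_error[of "link \<pi>\<^sub>0 g y" f ?F N,
        OF link_section(1,2)[OF y] link_section(3)[OF y] link_section(4)[OF y] fm F N]
    have i: "integrable ?P (\<lambda>xs. (imp_error \<pi>\<^sub>0 g N f (y, xs))\<^sup>2)"
      using ms(1) by (simp add: eq space_prior cong: Bochner_Integration.integrable_cong)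
    have "(\<integral>xs. (imp_error \<pi>\<^sub>0 g N f (y, xs))\<^sup>2 \<partial>?P)
        \<le> 4 * ?F\<^sup>2 * (\<integral>x. (link \<pi>\<^sub>0 g y x)\<^sup>2 \<partial>\<pi>\<^sub>0) / N"
      using ms(2) by (simp add: eq space_prior cong: Bochner_Integration.integral_cong)
    also have "\<dots> = ?b\<^sup>2"
      by (simp add: L2_norm_def power_mult_distrib power_divide)
    finally have "(\<integral>\<^sup>+xs. ennreal (\<bar>imp_error \<pi>\<^sub>0 g N f (y, xs)\<bar> ^ p) \<partial>?P) \<le> ennreal (?b ^ p)"
      using F0 by (intro P.nn_integral_abs_power_le_L2 m i p) (auto simp: L2_norm_def)
    also have "\<dots> = ennreal ((2 * ?F / sqrt N) ^ p) * ennreal (L2_norm \<pi>\<^sub>0 (link \<pi>\<^sub>0 g y) ^ p)"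
      using F0 by (subst ennreal_mult[symmetric]) (auto simp: L2_norm_def simp flip: power_mult_distrib)
    finally show ?thesis .
  qed
  have "(\<integral>\<^sup>+\<omega>. ennreal (\<bar>imp_error \<pi>\<^sub>0 g N f \<omega>\<bar> ^ p) \<partial>joint_law Y \<pi>\<^sub>0 g N)
      = (\<integral>\<^sup>+y. \<integral>\<^sup>+xs. ennreal (\<bar>imp_error \<pi>\<^sub>0 g N f (y, xs)\<bar> ^ p) \<partial>?P \<partial>obs_law Y \<pi>\<^sub>0 g)"
    unfolding joint_law_def by (rule P.nn_integral_fst[symmetric]) measurable
  also have "\<dots> \<le> (\<integral>\<^sup>+y. ennreal ((2 * ?F / sqrt N) ^ p) *
      ennreal (L2_norm \<pi>\<^sub>0 (link \<pi>\<^sub>0 g y) ^ p) \<partial>obs_law Y \<pi>\<^sub>0 g)"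
    by (intro nn_integral_mono sec) (simp add: space_obs_law)
  also have "\<dots> = ennreal ((2 * ?F / sqrt N) ^ p) *
       bochner_moment p (obs_law Y \<pi>\<^sub>0 g) \<pi>\<^sub>0 (link \<pi>\<^sub>0 g)"
    unfolding bochner_moment_def by (rule nn_integral_cmult) measurable
  finally show ?thesis .
qed

text \<open>Integrability is stated along with the rate because the Bochner integral of a
  non-integrable function is 0, which would make the norm bound vacuous.\<close>

lemma imp_error_rate:
  assumes f: "f \<in> bounded_measurable \<pi>\<^sub>0" and N: "N \<ge> 1" and p: "p \<in> {1, 2}"
    and K: "bochner_moment p (obs_law Y \<pi>\<^sub>0 g) \<pi>\<^sub>0 (link \<pi>\<^sub>0 g) \<le> ennreal K" "0 \<le> K"
  shows "integrable (joint_law Y \<pi>\<^sub>0 g N) (\<lambda>\<omega>. \<bar>imp_error \<pi>\<^sub>0 g N f \<omega>\<bar> ^ p)"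
    and "Lp_norm p (joint_law Y \<pi>\<^sub>0 g N) (imp_error \<pi>\<^sub>0 g N f)
      \<le> 2 * K powr (1 / p) * sup_norm \<pi>\<^sub>0 f / sqrt N"
proof -
  let ?J = "joint_law Y \<pi>\<^sub>0 g N" and ?b = "2 * sup_norm \<pi>\<^sub>0 f / sqrt N"
  have [measurable]: "imp_error \<pi>\<^sub>0 g N f \<in> borel_measurable ?J"
    using f by (intro imp_error_measurable) (simp add: bounded_measurable_def)
  have b: "0 \<le> ?b"
    using sup_norm_nonneg[OF f] by simp
  have le: "(\<integral>\<^sup>+\<omega>. ennreal (\<bar>imp_error \<pi>\<^sub>0 g N f \<omega>\<bar> ^ p) \<partial>?J) \<le> ennreal (?b ^ p * K)"
    using order.trans[OF nn_integral_imp_error_le[OF f N p] mult_left_mono[OF K(1)]] b K(2)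
    by (simp add: ennreal_mult)
  show i: "integrable ?J (\<lambda>\<omega>. \<bar>imp_error \<pi>\<^sub>0 g N f \<omega>\<bar> ^ p)"
    by (rule integrableI_bounded) (use le in \<open>auto simp: power_abs intro: order.strict_trans1\<close>)
  have "(\<integral>\<omega>. \<bar>imp_error \<pi>\<^sub>0 g N f \<omega>\<bar> ^ p \<partial>?J) \<le> ?b ^ p * K"
    using le b K(2) by (simp add: nn_integral_eq_integral[OF i])
  then have "Lp_norm p ?J (imp_error \<pi>\<^sub>0 g N f) \<le> (?b ^ p * K) powr (1 / p)"
    unfolding Lp_norm_def by (intro powr_mono2) auto
  also have "\<dots> = (?b ^ p) powr (1 / p) * K powr (1 / p)"
    using b K(2) by (simp add: powr_mult)
  \<comment> \<open>The two values of \<open>p\<close> are handled separately: a trivial root and a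
    square root.\<close>
  also have "(?b ^ p) powr (1 / p) = ?b"
    using p abs_of_nonneg[OF b] by (auto simp del: abs_divide simp add: powr_half_sqrt)
  finally show "Lp_norm p ?J (imp_error \<pi>\<^sub>0 g N f) \<le> 2 * K powr (1 / p) * sup_norm \<pi>\<^sub>0 f / sqrt N"
    by (simp add: mult_ac)
qed

end

section \<open>Uniformity over the state dimension\<close>

theorem corollary3p4:
  fixes X :: "nat \<Rightarrow> point set"
    and Y :: "(real ^ 'm) set"
    and \<pi>\<^sub>0 :: "nat \<Rightarrow> point measure"
    and g :: "nat \<Rightarrow> real ^ 'm \<Rightarrow> point \<Rightarrow> real"
    and p :: nat
    and \<K> :: ennreal
  assumes model: "\<And>d. d \<ge> 1 \<Longrightarrow> bayes_model d (X d) Y (\<pi>\<^sub>0 d) (g d)"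
    and p: "p \<in> {1, 2}"
    and link: "\<And>d. d \<ge> 1 \<Longrightarrow>
      bochner_p_integrable p (obs_law Y (\<pi>\<^sub>0 d) (g d)) (\<pi>\<^sub>0 d) (link (\<pi>\<^sub>0 d) (g d))"
    and K_finite: "\<K> < \<infinity>"
    and K_bound: "(SUP d\<in>{1..}.
      bochner_moment p (obs_law Y (\<pi>\<^sub>0 d) (g d)) (\<pi>\<^sub>0 d) (link (\<pi>\<^sub>0 d) (g d))) \<le> \<K>"
  shows "(\<exists>C::real. \<forall>d\<ge>1. \<forall>f\<in>bounded_measurable (\<pi>\<^sub>0 d). \<forall>N\<ge>1.
            integrable (joint_law Y (\<pi>\<^sub>0 d) (g d) N) (\<lambda>\<omega>. \<bar>imp_error (\<pi>\<^sub>0 d) (g d) N f \<omega>\<bar> ^ p) \<and>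
            Lp_norm p (joint_law Y (\<pi>\<^sub>0 d) (g d) N) (imp_error (\<pi>\<^sub>0 d) (g d) N f)
              \<le> C * sup_norm (\<pi>\<^sub>0 d) f / sqrt (real N))
       \<and> (\<forall>B::real. uniform_limit
            {(d, f). d \<ge> 1 \<and> f \<in> bounded_measurable (\<pi>\<^sub>0 d) \<and> sup_norm (\<pi>\<^sub>0 d) f \<le> B}
            (\<lambda>N (d, f). Lp_norm p (joint_law Y (\<pi>\<^sub>0 d) (g d) N) (imp_error (\<pi>\<^sub>0 d) (g d) N f))
            (\<lambda>_. 0) sequentially)"
proof -
  \<comment> \<open>The 2 is the square root of the 4 in the mean square bound; the other factor is
    the \<open>p\<close>-th root of the uniform moment bound. Finiteness of \<open>\<K>\<close>
    ensures that \<open>enn2real\<close> loses nothing.\<close>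
  define C where "C = 2 * enn2real \<K> powr (1 / real p)"
  have C0: "0 \<le> C"
    by (simp add: C_def)
  have rate: "integrable (joint_law Y (\<pi>\<^sub>0 d) (g d) N) (\<lambda>\<omega>. \<bar>imp_error (\<pi>\<^sub>0 d) (g d) N f \<omega>\<bar> ^ p)"
    "Lp_norm p (joint_law Y (\<pi>\<^sub>0 d) (g d) N) (imp_error (\<pi>\<^sub>0 d) (g d) N f)
      \<le> C * sup_norm (\<pi>\<^sub>0 d) f / sqrt (real N)"
    if "d \<ge> 1" "f \<in> bounded_measurable (\<pi>\<^sub>0 d)" "N \<ge> 1" for d f N
  proof -
    interpret bayes_model d "X d" Y "\<pi>\<^sub>0 d" "g d"
      by (rule model[OF that(1)])
    have "bochner_moment p (obs_law Y (\<pi>\<^sub>0 d) (g d)) (\<pi>\<^sub>0 d) (link (\<pi>\<^sub>0 d) (g d)) \<le> \<K>"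
      using K_bound that(1) by (simp add: SUP_le_iff)
    also have "\<K> = ennreal (enn2real \<K>)"
      using K_finite by simp
    finally have K: "bochner_moment p (obs_law Y (\<pi>\<^sub>0 d) (g d)) (\<pi>\<^sub>0 d) (link (\<pi>\<^sub>0 d) (g d))
        \<le> ennreal (enn2real \<K>)" .
    show "integrable (joint_law Y (\<pi>\<^sub>0 d) (g d) N) (\<lambda>\<omega>. \<bar>imp_error (\<pi>\<^sub>0 d) (g d) N f \<omega>\<bar> ^ p)"
      "Lp_norm p (joint_law Y (\<pi>\<^sub>0 d) (g d) N) (imp_error (\<pi>\<^sub>0 d) (g d) N f)
        \<le> C * sup_norm (\<pi>\<^sub>0 d) f / sqrt (real N)"
      using imp_error_rate[OF that(2,3) p K] by (simp_all add: C_def)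
  qed
  moreover have "uniform_limit
      {(d, f). d \<ge> 1 \<and> f \<in> bounded_measurable (\<pi>\<^sub>0 d) \<and> sup_norm (\<pi>\<^sub>0 d) f \<le> B}
      (\<lambda>N (d, f). Lp_norm p (joint_law Y (\<pi>\<^sub>0 d) (g d) N) (imp_error (\<pi>\<^sub>0 d) (g d) N f))
      (\<lambda>_. 0) sequentially" for B :: real
  proof (rule uniform_limitI)
    fix e :: real assume "0 < e"
    \<comment> \<open>This sequence dominates the error for all pairs \<open>(d, f)\<close> in the
      index set at once, so a single threshold for \<open>N\<close> serves them all.\<close>
    moreover have "(\<lambda>N. C * B / sqrt (real N)) \<longlonglongrightarrow> 0"
      by (intro tendsto_divide_0[OF tendsto_const] filterlim_at_top_imp_at_infinity
          filterlim_compose[OF sqrt_at_top filterlim_real_sequentially])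
    ultimately have "\<forall>\<^sub>F N in sequentially. C * B / sqrt (real N) < e"
      by (auto dest: order_tendstoD)
    then show "\<forall>\<^sub>F N in sequentially. \<forall>x\<in>{(d, f). d \<ge> 1 \<and> f \<in> bounded_measurable (\<pi>\<^sub>0 d) \<and>
        sup_norm (\<pi>\<^sub>0 d) f \<le> B}. dist ((\<lambda>(d, f). Lp_norm p (joint_law Y (\<pi>\<^sub>0 d) (g d) N)
        (imp_error (\<pi>\<^sub>0 d) (g d) N f)) x) 0 < e"
      using eventually_ge_at_top[of 1]
    proof eventually_elim
      case (elim N)
      have "Lp_norm p (joint_law Y (\<pi>\<^sub>0 d) (g d) N) (imp_error (\<pi>\<^sub>0 d) (g d) N f) < e"
        if "d \<ge> 1" "f \<in> bounded_measurable (\<pi>\<^sub>0 d)" "sup_norm (\<pi>\<^sub>0 d) f \<le> B" for d f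
      proof -
        have "C * sup_norm (\<pi>\<^sub>0 d) f / sqrt (real N) \<le> C * B / sqrt (real N)"
          using that(3) C0 by (intro divide_right_mono mult_left_mono) auto
        then show ?thesis
          using rate(2)[OF that(1,2) elim(2)] elim(1) by linarith
      qed
      then show ?case
        \<comment> \<open>\<open>Lp_norm\<close> is a value of \<open>powr\<close>, hence
          nonnegative, and its distance to 0 is the norm itself.\<close>
        by (auto simp: dist_real_def Lp_norm_def)
    qed
  qed
  ultimately show ?thesis
    by blast
qed

end
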